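(* Up to isomorphism, $G_{3,2}$ is the unique connected balanced bipartite graph of order $10$ and cycle rank $5$ that is a Parter graph but has no perfect matching.
   Context: All graphs are finite and simple, and all matrices are real and symmetric. For a graph $G$ with vertex set $\{1,\dots,n\}$, let $S(G)$ be the set of real symmetric $n\times n$ matrices $A=(a_{ij})$ such that for all $i\neq j$, $a_{ij}\neq 0$ if and only if $ij$ is an edge of $G$ (diagonal entries are arbitrary). For a vertex $v$, $A(v)$ denotes the principal submatrix of $A$ obtained by deleting the row and column indexed by $v$. A graph $G$ is called a Parter graph if there exists a nonsingular matrix $A\in S(G)$ such that $\det A(v)=0$ for every vertex $v$ of $G$ (equivalently, all diagonal entries of $A^{-1}$ are zero). The order of a graph is its number of vertices. The cycle rank of $G$ is $m(G)=|E(G)|-|V(G)|+k(G)$, where $k(G)$ is the number of connected components of $G$. A bipartite graph is balanced if its two partite sets have equal size. The graph $G_{3,2}$ is the bipartite graph with partite sets $U=\{u_1,\dots,u_5\}$ and $V=\{v_1,\dots,v_5\}$ whose edges are: $u_iv_j$ for $i\in\{1,2,3\}$, $j\in\{1,2\}$; $u_iv_j$ for $i\in\{4,5\}$, $j\in\{3,4,5\}$; and the two edges $u_4v_1$ and $u_5v_2$. *)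

theory Defs
  imports "Graph_Theory.Graph_Theory" "Jordan_Normal_Form.Determinant"
begin

text \<open>
  A finite simple graph is a \<^locale>\<open>pair_graph\<close>: finite vertex set, and a symmetric,
  loop-free set of arcs, so that each undirected edge \<open>uv\<close> is represented by the two arcs
  \<open>(u, v)\<close> and \<open>(v, u)\<close>.
\<close>

definition uedges :: "'a pair_pre_digraph \<Rightarrow> 'a set set" where
  "uedges G = {{u, v} | u v. (u, v) \<in> parcs G}"

text \<open>
  The strongly connected components of a symmetric digraph are the connected components of the
  graph it represents.
\<close>

definition cycle_rank :: "'a pair_pre_digraph \<Rightarrow> int" where
  "cycle_rank G = int (card (uedges G)) - int (card (pverts G))
     + int (card (pre_digraph.sccs_verts (with_proj G)))"

definition bipartition :: "'a pair_pre_digraph \<Rightarrow> 'a set \<Rightarrow> 'a set \<Rightarrow> bool" where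
  "bipartition G X Y \<longleftrightarrow> X \<union> Y = pverts G \<and> X \<inter> Y = {} \<and> parcs G \<subseteq> X \<times> Y \<union> Y \<times> X"

definition balanced_bipartite :: "'a pair_pre_digraph \<Rightarrow> bool" where
  "balanced_bipartite G \<longleftrightarrow> (\<exists>X Y. bipartition G X Y \<and> card X = card Y)"

definition perfect_matching :: "'a pair_pre_digraph \<Rightarrow> 'a set set \<Rightarrow> bool" where
  "perfect_matching G M \<longleftrightarrow> M \<subseteq> uedges G \<and> (\<forall>v \<in> pverts G. \<exists>!e. e \<in> M \<and> v \<in> e)"

text \<open>
  Matrices are indexed by \<open>0, \<dots>, n - 1\<close>, so the rows and columns of a matrix of a graph with
  arbitrary vertices are matched with the vertices by an enumeration
  \<open>f\<close> (a bijection from \<open>{..<n}\<close> onto the vertex set). Another enumeration only changes the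
  matrices by a simultaneous permutation of rows and columns, so the choice of \<open>f\<close> in
  \<open>parter_graph\<close> is immaterial.
\<close>

definition graph_mats :: "'a pair_pre_digraph \<Rightarrow> (nat \<Rightarrow> 'a) \<Rightarrow> real mat set" where
  "graph_mats G f = {A \<in> carrier_mat (card (pverts G)) (card (pverts G)).
     A\<^sup>T = A \<and>
     (\<forall>i < card (pverts G). \<forall>j < card (pverts G).
        i \<noteq> j \<longrightarrow> (A $$ (i, j) \<noteq> 0 \<longleftrightarrow> (f i, f j) \<in> parcs G))}"

definition parter_graph :: "'a pair_pre_digraph \<Rightarrow> bool" where
  "parter_graph G \<longleftrightarrow>
     (\<exists>f. bij_betw f {..<card (pverts G)} (pverts G) \<and>
       (\<exists>A \<in> graph_mats G f. det A \<noteq> 0 \<and>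
          (\<forall>i < card (pverts G). det (mat_delete A i i) = 0)))"

text \<open>The vertex \<open>u\<^sub>i\<close> is \<open>Inl i\<close> and the vertex \<open>v\<^sub>j\<close> is \<open>Inr j\<close>.\<close>

definition G32_uv :: "(nat \<times> nat) set" where
  "G32_uv = {1, 2, 3} \<times> {1, 2} \<union> {4, 5} \<times> {3, 4, 5} \<union> {(4, 1), (5, 2)}"

definition G32 :: "(nat + nat) pair_pre_digraph" where
  "G32 = \<lparr> pverts = Inl ` {1..5} \<union> Inr ` {1..5},
     parcs = (\<lambda>(i, j). (Inl i, Inr j)) ` G32_uv \<union> (\<lambda>(i, j). (Inr j, Inl i)) ` G32_uv \<rparr>"

end

theory Submission
  imports Defs
begin

text \<open>
  If \<open>A\<close> is a nonsingular matrix of \<open>G\<close> and \<open>C = A\<^sup>-\<^sup>1\<close> has zero diagonal, then the weights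
  \<open>a x y * c y x\<close> on the edges at any vertex \<open>x\<close> add up to 1. Hence a vertex \<open>u\<close> whose only
  neighbour is \<open>v\<close> forces the row \<open>v\<close> of \<open>C\<close> to vanish off \<open>u\<close>, and at a cut vertex each
  component carries weight 0 or 1.

  Without a perfect matching, Hall's theorem gives \<open>S \<subseteq> X\<close> with \<open>card T < card S\<close> for the
  neighbourhood \<open>T\<close> of \<open>S\<close>; then \<open>Y - T\<close> is deficient too, with neighbourhood inside
  \<open>X - S\<close>. The pendant argument gives \<open>card T \<ge> 2\<close> and \<open>card (X - S) \<ge> 2\<close>, so
  \<open>card S = 3\<close> and \<open>card T = 2\<close>, and it also forces \<open>S \<times> T\<close> and \<open>(X - S) \<times> (Y - T)\<close> to
  consist of edges. This leaves two edges between \<open>X - S\<close> and \<open>T\<close>; if they shared an endpoint,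
  that endpoint would be a cut vertex with a component of weight 2.
\<close>

section \<open>Hall's marriage theorem\<close>

text \<open>Induction over proper subsets, for all \<open>N\<close> at once. If some nonempty proper
  subset \<open>S\<close> is tight, \<open>S\<close> and \<open>X - S\<close> are matched
  separately; otherwise every such subset has a neighbour to spare, and any single pair may be
  matched first.\<close>

theorem hall_marriage:
  fixes N :: "'a \<Rightarrow> 'b set"
  assumes "finite X" "\<And>x. x \<in> X \<Longrightarrow> finite (N x)"
    and "\<And>S. S \<subseteq> X \<Longrightarrow> card S \<le> card (\<Union>(N ` S))"
  shows "\<exists>f. inj_on f X \<and> (\<forall>x\<in>X. f x \<in> N x)"
  using assms
proof (induction X arbitrary: N rule: finite_psubset_induct)
  case (psubset X)
  note fin = psubset.prems(1) and hall = psubset.prems(2)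
  have finU: "finite (\<Union>(N ` S))" if "S \<subseteq> X" for S
    using that fin \<open>finite X\<close> by (blast intro: finite_subset)
  show ?case
  proof (cases "\<exists>S. S \<noteq> {} \<and> S \<subset> X \<and> card (\<Union>(N ` S)) \<le> card S")
    case True
    then obtain S where S: "S \<noteq> {}" "S \<subset> X" "card (\<Union>(N ` S)) \<le> card S" by blast
    define W where "W = \<Union>(N ` S)"
    have finS: "finite S" and finW: "finite W"
      using S \<open>finite X\<close> finU by (auto simp: W_def intro: finite_subset)
    have "\<exists>f. inj_on f S \<and> (\<forall>x\<in>S. f x \<in> N x)"
      using S fin hall by (intro psubset.IH) auto
    then obtain f where f: "inj_on f S" "\<And>x. x \<in> S \<Longrightarrow> f x \<in> N x" by blast
    have "\<exists>g. inj_on g (X - S) \<and> (\<forall>x\<in>X - S. g x \<in> N x - W)"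
    proof (rule psubset.IH)
      fix R assume R: "R \<subseteq> X - S"
      then have "finite R" using \<open>finite X\<close> by (auto intro: finite_subset)
      \<comment> \<open>Hall's condition for \<open>R \<union> S\<close>: the tight set accounts for
        at most \<open>card S\<close> of the neighbours, so at least \<open>card R\<close> of them
        lie outside \<open>W\<close>.\<close>
      have "card R + card S = card (R \<union> S)"
        using R finS \<open>finite R\<close> by (subst card_Un_disjoint) auto
      also have "\<dots> \<le> card (\<Union>(N ` (R \<union> S)))"
        using R S by (intro hall) auto
      also have "\<Union>(N ` (R \<union> S)) = \<Union>((\<lambda>x. N x - W) ` R) \<union> W"
        by (auto simp: W_def)
      also have "card \<dots> \<le> card (\<Union>((\<lambda>x. N x - W) ` R)) + card W"
        by (rule card_Un_le)
      finally show "card R \<le> card (\<Union>((\<lambda>x. N x - W) ` R))"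
        using S by (simp add: W_def)
    qed (use S fin in auto)
    then obtain g where g: "inj_on g (X - S)" "\<And>x. x \<in> X - S \<Longrightarrow> g x \<in> N x - W" by blast
    define h where "h x = (if x \<in> S then f x else g x)" for x
    have "f x \<noteq> g y" if "x \<in> S" "y \<in> X - S" for x y
      using f(2)[OF that(1)] g(2)[OF that(2)] that by (auto simp: W_def)
    then have "h ` S \<inter> h ` (X - S) = {}"
      by (fastforce simp: h_def)
    moreover have "inj_on h S" "inj_on h (X - S)"
      using f(1) g(1) by (auto simp: inj_on_def h_def)
    ultimately have "inj_on h (S \<union> (X - S))"
      by (simp add: inj_on_Un Diff_Int_distrib2 Diff_eq)
    moreover have "S \<union> (X - S) = X" using S by blast
    ultimately have "inj_on h X" by simp
    moreover have "\<forall>x\<in>X. h x \<in> N x"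
      using f(2) g(2) by (auto simp: h_def)
    ultimately show ?thesis by blast
  next
    case strict: False
    show ?thesis
    proof (cases "X = {}")
      case False
      then obtain x where x: "x \<in> X" by blast
      from hall[of "{x}"] x have "N x \<noteq> {}" by auto
      then obtain y where y: "y \<in> N x" by blast
      have "\<exists>f. inj_on f (X - {x}) \<and> (\<forall>z\<in>X - {x}. f z \<in> N z - {y})"
      proof (rule psubset.IH)
        fix R assume R: "R \<subseteq> X - {x}"
        show "card R \<le> card (\<Union>((\<lambda>z. N z - {y}) ` R))"
        proof (cases "R = {}")
          case False
          moreover have "R \<subset> X" using R x by blast
          \<comment> \<open>Strictness leaves one neighbour to spare, which pays for the removal of
            \<open>y\<close>.\<close>
          ultimately have "card R < card (\<Union>(N ` R))"
            using strict by (meson not_le)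
          moreover have "\<Union>((\<lambda>z. N z - {y}) ` R) = \<Union>(N ` R) - {y}" by auto
          ultimately show ?thesis
            using card_Diff_singleton_if[of "\<Union>(N ` R)" y] by auto
        qed simp
      qed (use x fin in auto)
      then obtain f where f: "inj_on f (X - {x})" "\<And>z. z \<in> X - {x} \<Longrightarrow> f z \<in> N z - {y}" by blast
      have "inj_on (f(x := y)) X"
        using f by (auto simp: inj_on_def)
      moreover have "\<forall>z\<in>X. (f(x := y)) z \<in> N z"
        using f(2) y by auto
      ultimately show ?thesis by blast
    qed simp
  qed
qed

section \<open>Inverse matrices with zero diagonal\<close>

text \<open>Functions on the vertices replace matrices, which keeps the argument free of
  enumerations. \<open>c\<close> is the inverse of \<open>a\<close>, and \<open>c_diag\<close> is
  the Parter condition.\<close>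

locale hollow_inverse =
  fixes V :: "'a set" and a c :: "'a \<Rightarrow> 'a \<Rightarrow> real"
  assumes finite_V: "finite V"
    and a_sym: "x \<in> V \<Longrightarrow> y \<in> V \<Longrightarrow> a x y = a y x"
    and c_sym: "x \<in> V \<Longrightarrow> y \<in> V \<Longrightarrow> c x y = c y x"
    and c_diag: "x \<in> V \<Longrightarrow> c x x = 0"
    and inverse: "x \<in> V \<Longrightarrow> z \<in> V \<Longrightarrow> (\<Sum>y\<in>V. a x y * c y z) = (if x = z then 1 else 0)"
begin

text \<open>\<open>T\<close> only bounds the neighbourhood of \<open>x\<close> from above, so one
  \<open>T\<close> can serve all vertices of a deficient set.\<close>

definition nbrs_within :: "'a \<Rightarrow> 'a set \<Rightarrow> bool" where
  "nbrs_within x T \<longleftrightarrow> x \<in> V \<and> x \<notin> T \<and> T \<subseteq> V \<and> (\<forall>y\<in>V. y \<noteq> x \<longrightarrow> a x y \<noteq> 0 \<longrightarrow> y \<in> T)"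

lemma nbrs_withinD: "nbrs_within x T \<Longrightarrow> y \<in> V \<Longrightarrow> y \<noteq> x \<Longrightarrow> y \<notin> T \<Longrightarrow> a x y = 0"
  unfolding nbrs_within_def by blast

lemma row_nbrs:
  assumes "nbrs_within x T" "z \<in> V"
  shows "a x x * c x z + (\<Sum>y\<in>T. a x y * c y z) = (if x = z then 1 else 0)"
proof -
  have T: "x \<in> V" "x \<notin> T" "T \<subseteq> V" and nz: "\<And>y. y \<in> V \<Longrightarrow> y \<noteq> x \<Longrightarrow> a x y \<noteq> 0 \<Longrightarrow> y \<in> T"
    using assms(1) by (auto simp: nbrs_within_def)
  have "(\<Sum>y\<in>V. a x y * c y z) = (\<Sum>y\<in>insert x T. a x y * c y z)"
    using T nz finite_V by (intro sum.mono_neutral_right) auto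
  also have "\<dots> = a x x * c x z + (\<Sum>y\<in>T. a x y * c y z)"
    using T finite_V by (intro sum.insert) (auto intro: finite_subset)
  finally show ?thesis using inverse[OF T(1) assms(2)] by simp
qed

section \<open>Edge weights and pendant vertices\<close>

lemma weight_sum:
  assumes "nbrs_within x T"
  shows "(\<Sum>y\<in>T. a x y * c y x) = 1"
  using row_nbrs[OF assms, of x] assms c_diag[of x] by (simp add: nbrs_within_def)

text \<open>The edge \<open>u v\<close> carries the full weight 1, so \<open>c v u\<close> is
  nonzero. Column \<open>v\<close> of row \<open>u\<close> then gives \<open>a u u = 0\<close>, and
  row \<open>u\<close> reduces to \<open>a u v * c v k = 0\<close>.\<close>

lemma pendant:
  assumes "nbrs_within u {v}" "k \<in> V" "k \<noteq> u"
  shows "c v k = 0"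
proof -
  have uv: "u \<in> V" "v \<in> V" "u \<noteq> v" using assms(1) by (auto simp: nbrs_within_def)
  have w: "a u v * c v u = 1" using weight_sum[OF assms(1)] by simp
  have "a u u * c u v = 0"
    using row_nbrs[OF assms(1) uv(2)] uv c_diag[OF uv(2)] by simp
  with w c_sym[OF uv(1,2)] have "a u u = 0" by auto
  with row_nbrs[OF assms(1,2)] assms(3) w show ?thesis by auto
qed

text \<open>An empty \<open>T\<close> leaves no weight to add up to 1. If \<open>T = {v}\<close>,
  two vertices of \<open>S\<close> hang on \<open>v\<close>, and \<open>pendant\<close> at one of
  them removes the weight of the other.\<close>

lemma card_nbrs_ge_2:
  assumes nb: "\<And>x. x \<in> S \<Longrightarrow> nbrs_within x T" and lt: "card T < card S"
  shows "2 \<le> card T"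
proof (rule ccontr)
  assume "\<not> 2 \<le> card T"
  then consider "card T = 0" | "card T = 1" by linarith
  then show False
  proof cases
    case 1
    from lt obtain x where x: "x \<in> S" by fastforce
    have "finite T" using nb[OF x] finite_V by (auto simp: nbrs_within_def intro: finite_subset)
    with 1 have "T = {}" by simp
    with weight_sum[OF nb[OF x]] show False by simp
  next
    case 2
    then obtain v where T: "T = {v}" by (auto simp: card_1_singleton_iff)
    have "\<not> (\<forall>x\<in>S. \<forall>y\<in>S. x = y)"
      using lt 2 card_le_Suc0_iff_eq[of S] card.infinite by fastforce
    then obtain x y where xy: "x \<in> S" "y \<in> S" "x \<noteq> y" by blast
    have "y \<in> V" using nb[OF xy(2)] by (auto simp: nbrs_within_def)
    then have "c v y = 0" using pendant[of x v y] nb[OF xy(1)] T xy by auto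
    with weight_sum[OF nb[OF xy(2)]] T show False by simp
  qed
qed

text \<open>The pendant vertex \<open>x\<close> clears row \<open>t\<close> of \<open>c\<close> off
  \<open>x\<close>, so \<open>y\<close> and \<open>z\<close> behave like two pendant vertices at
  \<open>t'\<close>: each has weight 1 there, and the argument of \<open>pendant\<close>, repeated
  for \<open>y\<close>, forces \<open>c t' z = 0\<close>.\<close>

lemma no_pendant_over_two:
  assumes "nbrs_within x {t}" "nbrs_within y {t, t'}" "nbrs_within z {t, t'}"
    and "x \<noteq> y" "x \<noteq> z" "y \<noteq> z" "t \<noteq> t'"
  shows False
proof -
  have V: "x \<in> V" "y \<in> V" "z \<in> V" "t \<in> V" "t' \<in> V"
    and ne: "y \<noteq> t" "y \<noteq> t'" "z \<noteq> t" "z \<noteq> t'" "x \<noteq> t"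
    using assms(1-3) by (auto simp: nbrs_within_def)
  have ct: "c t k = 0" if "k \<in> V" "k \<noteq> x" for k
    using pendant[OF assms(1) that] .
  have wz: "a z t' * c t' z = 1"
    using weight_sum[OF assms(3)] ct[OF V(3)] assms by simp
  have wy: "a y t' * c t' y = 1"
    using weight_sum[OF assms(2)] ct[OF V(2)] assms by simp
  \<comment> \<open>Row \<open>t\<close> of \<open>c\<close> is known to vanish only off
    \<open>x\<close>, so \<open>c t t' = 0\<close> depends on this.\<close>
  have "x \<noteq> t'"
  proof
    assume "x = t'"
    have "a x y = 0" using assms(4) V ne by (intro nbrs_withinD[OF assms(1)]) auto
    then have "a y t' = 0" using a_sym[OF V(1,2)] \<open>x = t'\<close> by simp
    then show False using wy by simp
  qed
  then have "a y y * c y t' = 0"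
    using row_nbrs[OF assms(2) V(5)] ct[of t'] c_diag[of t'] V ne assms(7) by simp
  with wy c_sym[of y t'] V have ayy: "a y y = 0" by auto
  have "c t' z = 0"
    using row_nbrs[OF assms(2) V(3)] ct[of z] V ayy assms wy by auto
  with wz show False by simp
qed

text \<open>A missing edge \<open>s t\<close> would leave \<open>s\<close> with the other vertex of
  \<open>T\<close> as its only possible neighbour, which is the case that
  \<open>no_pendant_over_two\<close> excludes.\<close>

lemma complete_to_two:
  assumes nb: "\<And>x. x \<in> S \<Longrightarrow> nbrs_within x T" and "card S = 3" "card T = 2"
    and "s \<in> S" "t \<in> T"
  shows "a s t \<noteq> 0"
proof
  assume "a s t = 0"
  from assms(3,5) obtain t' where T: "T = {t', t}" "t' \<noteq> t"
    by (auto simp: card_2_iff)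
  have "card (S - {s}) = 2" using assms by simp
  then obtain y z where yz: "S - {s} = {y, z}" "y \<noteq> z" by (auto simp: card_2_iff)
  then have "y \<in> S" "z \<in> S" "s \<noteq> y" "s \<noteq> z" by auto
  moreover have "nbrs_within s {t'}"
    using nb[OF \<open>s \<in> S\<close>] \<open>a s t = 0\<close> T unfolding nbrs_within_def by blast
  ultimately show False
    using no_pendant_over_two[of s t' y t z] nb[of y] nb[of z] T yz by auto
qed

section \<open>Cut vertices\<close>

text \<open>
  Let \<open>K\<close> be a union of components of \<open>V - {v}\<close>. The restriction of the column \<open>v\<close> of \<open>c\<close> to
  \<open>K\<close> is mapped by \<open>a\<close> to a multiple \<open>s\<close> of the unit vector at \<open>v\<close>, so it is \<open>s\<close> times
  that column; comparing the two inside and outside \<open>K\<close> gives \<open>s = 0\<close> or \<open>s = 1\<close>.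
\<close>

lemma cut_vertex_weight:
  assumes v: "v \<in> V" and K: "K \<subseteq> V - {v}"
    and sep: "\<And>x y. x \<in> K \<Longrightarrow> y \<in> V - K - {v} \<Longrightarrow> a x y = 0"
  shows "(\<Sum>y\<in>K. a v y * c y v) \<in> {0, 1}"
proof -
  define s where "s = (\<Sum>y\<in>K. a v y * c y v)"
  define x where "x y = (if y \<in> K then c y v else 0)" for y
  have restr: "(\<Sum>y\<in>V. a z y * x y) = (\<Sum>y\<in>K. a z y * c y v)" for z
    unfolding x_def using K finite_V by (intro sum.mono_neutral_cong_right) auto
  have ax: "(\<Sum>y\<in>V. a z y * x y) = (if z = v then s else 0)" if z: "z \<in> V" for z
  proof -
    consider "z = v" | "z \<in> K" "z \<noteq> v" | "z \<in> V - K - {v}" using z by blast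
    then show ?thesis
    proof cases
      case 2
      have "(\<Sum>y\<in>K. a z y * c y v) = (\<Sum>y\<in>V. a z y * c y v)"
        using K finite_V 2 sep[OF 2(1)] c_diag[OF v] by (intro sum.mono_neutral_left) auto
      with 2 inverse[OF z v] restr show ?thesis by simp
    next
      case 3
      then have "(\<Sum>y\<in>K. a z y * c y v) = 0"
        using sep K a_sym by (intro sum.neutral) (metis Diff_iff mult_zero_left subsetD)
      with 3 restr show ?thesis by auto
    qed (simp add: restr s_def)
  qed
  have xc: "x z = s * c z v" if z: "z \<in> V" for z
  proof -
    have "x z = (\<Sum>y\<in>V. (if z = y then 1 else 0) * x y)"
      using z finite_V by (simp add: if_distrib[of "\<lambda>t. t * _"] cong: if_cong)
    also have "\<dots> = (\<Sum>y\<in>V. (\<Sum>u\<in>V. a y u * c u z) * x y)"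
      using z inverse by (intro sum.cong) auto
    also have "\<dots> = (\<Sum>y\<in>V. \<Sum>u\<in>V. c z u * (a u y * x y))"
      unfolding sum_distrib_right using z a_sym c_sym by (intro sum.cong) (auto simp: mult_ac)
    also have "\<dots> = (\<Sum>u\<in>V. c z u * (\<Sum>y\<in>V. a u y * x y))"
      by (subst sum.swap) (simp add: sum_distrib_left)
    also have "\<dots> = (\<Sum>u\<in>V. c z u * (if u = v then s else 0))"
      using ax by (intro sum.cong) auto
    also have "\<dots> = s * c z v"
      using v finite_V by (simp add: if_distrib[of "\<lambda>t. _ * t"] cong: if_cong)
    finally show ?thesis .
  qed
  \<comment> \<open>On \<open>K\<close> the identity \<open>xc\<close> reads
    \<open>c y v = s * c y v\<close>; weighting by \<open>a v y\<close> and summing turns it into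
    \<open>s = s * s\<close>.\<close>
  have "s = (\<Sum>y\<in>K. a v y * (s * c y v))"
    unfolding s_def[symmetric]
  proof (subst s_def, rule sum.cong)
    fix y assume "y \<in> K"
    then have "c y v = s * c y v" using xc[of y] K by (auto simp: x_def)
    then show "a v y * c y v = a v y * (s * c y v)" by simp
  qed simp
  also have "\<dots> = s * s"
    by (simp add: s_def sum_distrib_left mult_ac)
  finally show ?thesis by (auto simp: s_def)
qed

text \<open>The three vertices of \<open>S\<close> have total weight 3, all of it on edges to
  \<open>t\<close> or \<open>t'\<close>. The edges at \<open>t'\<close> carry 1; those at
  \<open>t\<close>, which separates \<open>insert t' S\<close> from the rest, carry 0 or 1. So 3 is
  out of reach.\<close>

lemma no_cut_vertex_over_two:
  assumes nb: "\<And>x. x \<in> S \<Longrightarrow> nbrs_within x {t, t'}" and "card S = 3" "t \<noteq> t'"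
    and nb': "nbrs_within t' S"
  shows False
proof -
  have finS: "finite S" and "S \<noteq> {}" using assms(2) by (auto intro: card_ge_0_finite)
  then obtain s where "s \<in> S" by blast
  have V: "t \<in> V" "t' \<in> V" "S \<subseteq> V" "t \<notin> S" "t' \<notin> S"
    using nb nb' nb[OF \<open>s \<in> S\<close>] by (auto simp: nbrs_within_def)
  have tt: "a t t' = 0"
    using nbrs_withinD[OF nb', of t] a_sym[of t t'] V assms(3) by simp
  have "(\<Sum>y\<in>insert t' S. a t y * c y t) \<in> {0, 1}"
  proof (rule cut_vertex_weight)
    fix x y assume x: "x \<in> insert t' S" and y: "y \<in> V - insert t' S - {t}"
    have "y \<in> V" "y \<noteq> x" "y \<notin> S" "y \<notin> {t, t'}" using x y by auto
    then show "a x y = 0"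
      using x nb[of x] nb' by (auto intro: nbrs_withinD)
  qed (use V assms in auto)
  then have cut: "(\<Sum>y\<in>S. a t y * c y t) \<in> {0, 1}"
    using finS V tt by simp
  have "3 = (\<Sum>s\<in>S. \<Sum>y\<in>{t, t'}. a s y * c y s)"
    using weight_sum[OF nb] assms(2) by simp
  also have "\<dots> = (\<Sum>s\<in>S. a t s * c s t) + (\<Sum>s\<in>S. a t' s * c s t')"
    unfolding sum.distrib[symmetric]
  proof (rule sum.cong)
    fix s assume "s \<in> S"
    then have "s \<in> V" using V by blast
    then show "(\<Sum>y\<in>{t, t'}. a s y * c y s) = a t s * c s t + a t' s * c s t'"
      using V assms(3) by (simp add: a_sym[of s] c_sym[of _ s])
  qed simp
  also have "(\<Sum>s\<in>S. a t' s * c s t') = 1"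
    by (rule weight_sum[OF nb'])
  finally show False using cut by auto
qed

section \<open>The edge set forced by a deficient set\<close>

lemma structure_of_deficient:
  assumes XY: "V = X \<union> Y" "X \<inter> Y = {}" and card_X: "card X = 5" and card_Y: "card Y = 5"
    and indep: "\<And>x y. x \<in> V \<Longrightarrow> y \<in> V \<Longrightarrow> x \<noteq> y \<Longrightarrow> a x y \<noteq> 0 \<Longrightarrow> x \<in> X \<longleftrightarrow> y \<in> Y"
    and E: "E = {(x, y) \<in> X \<times> Y. a x y \<noteq> 0}" "card E = 14"
    and S: "S \<subseteq> X" and T: "T = {y \<in> Y. \<exists>x\<in>S. a x y \<noteq> 0}" and deficient: "card T < card S"
  obtains s1 s2 s3 p p' t t' r1 r2 r3
  where "distinct [s1, s2, s3, p, p', t, t', r1, r2, r3]"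
    and "X = {s1, s2, s3, p, p'}" and "Y = {t, t', r1, r2, r3}"
    and "E = {s1, s2, s3} \<times> {t, t'} \<union> {p, p'} \<times> {r1, r2, r3} \<union> {(p, t), (p', t')}"
proof -
  define P where "P = X - S"
  define R where "R = Y - T"
  have fin: "finite X" "finite Y" using card_X card_Y by (auto intro: card_ge_0_finite)
  have "T \<subseteq> Y" using T by blast
  then have finST: "finite S" "finite T" "finite P" "finite R"
    using S fin by (auto simp: P_def R_def intro: finite_subset)
  have nbS: "nbrs_within x T" if "x \<in> S" for x
    using that S T XY indep unfolding nbrs_within_def by blast
  have nbR: "nbrs_within y P" if "y \<in> R" for y
    unfolding nbrs_within_def
  proof (intro conjI ballI impI)
    fix z assume z: "z \<in> V" "z \<noteq> y" "a y z \<noteq> 0"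
    have y: "y \<in> V" "y \<in> Y" "y \<notin> T" "y \<notin> X" using that XY by (auto simp: R_def)
    have "z \<in> X" using indep[OF y(1) z(1)] z y XY by blast
    moreover have "z \<notin> S" using y z a_sym[of y z] T by auto
    ultimately show "z \<in> P" by (simp add: P_def)
  qed (use that XY in \<open>auto simp: P_def R_def\<close>)
  have cP: "card P = 5 - card S" and cR: "card R = 5 - card T"
    using card_Diff_subset[OF finST(1) S] card_Diff_subset[OF finST(2) \<open>T \<subseteq> Y\<close>]
    by (auto simp: P_def R_def card_X card_Y)
  have "card S \<le> 5" using card_mono[OF fin(1) S] card_X by simp
  have "2 \<le> card T" using card_nbrs_ge_2[OF nbS deficient] .
  \<comment> \<open>\<open>R\<close> is deficient as well:
    \<open>card P = 5 - card S < 5 - card T = card R\<close>.\<close>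
  moreover have "2 \<le> card P"
    using deficient \<open>card S \<le> 5\<close> by (intro card_nbrs_ge_2[OF nbR]) (auto simp: cP cR)
  \<comment> \<open>Here \<open>card P \<ge> 2\<close> means \<open>card S \<le> 3\<close>, and
    \<open>2 \<le> card T < card S \<le> 3\<close> leaves one case.\<close>
  ultimately have cS: "card S = 3" and cT: "card T = 2"
    using deficient cP by auto
  have cP: "card P = 2" and cR: "card R = 3" using cP cR cS cT by auto
  have aST: "a s t \<noteq> 0" if "s \<in> S" "t \<in> T" for s t
    using complete_to_two[OF nbS cS cT that] .
  have aPR: "a p r \<noteq> 0" if "p \<in> P" "r \<in> R" for p r
    using complete_to_two[OF nbR cR cP that(2,1)] a_sym[of p r] that XY by (auto simp: P_def R_def)
  have aSR: "a s r = 0" if "s \<in> S" "r \<in> R" for s r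
    using that T by (auto simp: R_def)
  define F where "F = {(p, t) \<in> P \<times> T. a p t \<noteq> 0}"
  have E_eq: "E = S \<times> T \<union> P \<times> R \<union> F"
    using aST aPR aSR S \<open>T \<subseteq> Y\<close> unfolding E F_def P_def R_def by blast
  have "finite F"
    using finST by (auto simp: F_def intro: finite_subset[of _ "P \<times> T"])
  have "card E = card (S \<times> T) + card (P \<times> R) + card F"
    unfolding E_eq using finST \<open>finite F\<close>
    by (subst card_Un_disjoint, auto simp: F_def P_def R_def)
       (subst card_Un_disjoint, auto simp: P_def R_def)
  \<comment> \<open>Each of the two complete blocks takes 6 of the 14 edges, and there are none
    between \<open>S\<close> and \<open>R\<close>.\<close>
  then have cF: "card F = 2"
    using E(2) by (simp add: card_cartesian_product cS cT cP cR)
  \<comment> \<open>Otherwise all neighbours of \<open>t\<close> lie in \<open>S\<close>, and the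
    other vertex of \<open>T\<close> separates \<open>S\<close> and \<open>t\<close> from the
    rest.\<close>
  have nbT: "\<exists>p\<in>P. a p t \<noteq> 0" if t: "t \<in> T" for t
  proof (rule ccontr)
    assume no: "\<not> (\<exists>p\<in>P. a p t \<noteq> 0)"
    from cT t obtain t' where T': "T = {t', t}" "t' \<noteq> t" by (auto simp: card_2_iff)
    have tV: "t \<in> V" "t \<in> Y" "t \<notin> X" using t XY \<open>T \<subseteq> Y\<close> by auto
    have "nbrs_within t S"
      unfolding nbrs_within_def
    proof (intro conjI ballI impI)
      fix z assume z: "z \<in> V" "z \<noteq> t" "a t z \<noteq> 0"
      have "z \<in> X" using indep[OF tV(1) z(1)] z tV XY by blast
      then show "z \<in> S" using no a_sym[OF tV(1) z(1)] z(3) by (auto simp: P_def)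
    qed (use S tV XY in auto)
    then show False
      using no_cut_vertex_over_two[of S t' t] nbS cS T' by auto
  qed
  \<comment> \<open>The mirror image, with \<open>R\<close> over \<open>P\<close> in place of
    \<open>S\<close> over \<open>T\<close>.\<close>
  have nbP: "\<exists>t\<in>T. a p t \<noteq> 0" if p: "p \<in> P" for p
  proof (rule ccontr)
    assume no: "\<not> (\<exists>t\<in>T. a p t \<noteq> 0)"
    from cP p obtain p' where P': "P = {p', p}" "p' \<noteq> p" by (auto simp: card_2_iff)
    have pV: "p \<in> V" "p \<in> X" "p \<notin> Y" using p XY by (auto simp: P_def)
    have "nbrs_within p R"
      unfolding nbrs_within_def
    proof (intro conjI ballI impI)
      fix z assume z: "z \<in> V" "z \<noteq> p" "a p z \<noteq> 0"
      have "z \<in> Y" using indep[OF pV(1) z(1)] z pV by blast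
      then show "z \<in> R" using no z(3) by (auto simp: R_def)
    qed (use pV XY in \<open>auto simp: R_def\<close>)
    then show False
      using no_cut_vertex_over_two[of R p' p] nbR cR P' by auto
  qed
  obtain p p' where P: "P = {p, p'}" "p \<noteq> p'" using cP by (auto simp: card_2_iff)
  obtain t where t: "t \<in> T" "a p t \<noteq> 0" using nbP[of p] P by auto
  obtain t' where T': "T = {t, t'}" "t \<noteq> t'" using cT t(1) by (auto simp: card_2_iff)
  \<comment> \<open>Otherwise \<open>p'\<close> has to meet \<open>t\<close> and \<open>t'\<close>
    has to meet \<open>p\<close>, which together with the edge \<open>p t\<close> puts three edges
    into \<open>F\<close>.\<close>
  have "a p' t' \<noteq> 0"
  proof
    assume "a p' t' = 0"
    then have "a p' t \<noteq> 0" "a p t' \<noteq> 0" using nbP[of p'] nbT[of t'] P T' by auto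
    then have "{(p, t), (p', t), (p, t')} \<subseteq> F" using t P T' by (auto simp: F_def)
    then have "card {(p, t), (p', t), (p, t')} \<le> card F" by (rule card_mono[OF \<open>finite F\<close>])
    then show False using P T' cF by simp
  qed
  then have "{(p, t), (p', t')} \<subseteq> F" using t P T' by (auto simp: F_def)
  then have F: "{(p, t), (p', t')} = F"
    using P cF \<open>finite F\<close> by (intro card_subset_eq) auto
  obtain s1 s2 s3 where S': "S = {s1, s2, s3}" "s1 \<noteq> s2" "s1 \<noteq> s3" "s2 \<noteq> s3"
    using cS by (auto simp: card_3_iff)
  obtain r1 r2 r3 where R: "R = {r1, r2, r3}" "r1 \<noteq> r2" "r1 \<noteq> r3" "r2 \<noteq> r3"
    using cR by (auto simp: card_3_iff)
  have X: "X = S \<union> P" "S \<inter> P = {}" and Y: "Y = T \<union> R" "T \<inter> R = {}"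
    using S \<open>T \<subseteq> Y\<close> by (auto simp: P_def R_def)
  show thesis
  proof (rule that)
    show "X = {s1, s2, s3, p, p'}" "Y = {t, t', r1, r2, r3}"
      using X Y S' P T' R by auto
    show "E = {s1, s2, s3} \<times> {t, t'} \<union> {p, p'} \<times> {r1, r2, r3} \<union> {(p, t), (p', t')}"
      using E_eq S' P(1) T' R F by simp
    show "distinct [s1, s2, s3, p, p', t, t', r1, r2, r3]"
      using X Y XY(2) S' P T' R by auto
  qed
qed

end

section \<open>Parter graphs and perfect matchings\<close>

text \<open>Transposition exchanges the deleted row and column. This makes the adjugate symmetric,
  as \<open>c_sym\<close> demands.\<close>

lemma det_mat_delete_swap:
  assumes A: "A \<in> carrier_mat n n" and sym: "A\<^sup>T = A" and ij: "i < n" "j < n"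
  shows "det (mat_delete A i j) = det (mat_delete A j i)"
proof -
  have entry: "A $$ (p, q) = A $$ (q, p)" if "p < n" "q < n" for p q
    using arg_cong[OF sym, of "\<lambda>B. B $$ (p, q)"] that A by simp
  have "(mat_delete A i j)\<^sup>T = mat_delete A j i"
    using A ij by (intro eq_matI) (auto simp: mat_delete_def intro!: entry)
  then show ?thesis
    using det_transpose[OF mat_delete_carrier[OF A], of i j] by simp
qed

text \<open>\<open>c\<close> is the adjugate divided by the determinant; its diagonal consists of
  the vertex-deleted minors over \<open>det A\<close>, which vanish.\<close>

lemma parter_graphD:
  assumes fin: "finite (pverts G)" and parter: "parter_graph G"
  obtains a c where "hollow_inverse (pverts G) a c"
    "\<And>x y. x \<in> pverts G \<Longrightarrow> y \<in> pverts G \<Longrightarrow> x \<noteq> y \<Longrightarrow> a x y \<noteq> 0 \<longleftrightarrow> (x, y) \<in> parcs G"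
proof -
  define n where "n = card (pverts G)"
  from parter obtain f A where f: "bij_betw f {..<n} (pverts G)" and A: "A \<in> graph_mats G f"
    and dA: "det A \<noteq> 0" and dd: "\<And>i. i < n \<Longrightarrow> det (mat_delete A i i) = 0"
    unfolding parter_graph_def n_def by blast
  have cA: "A \<in> carrier_mat n n" and sA: "A\<^sup>T = A"
    and pat: "\<And>i j. i < n \<Longrightarrow> j < n \<Longrightarrow> i \<noteq> j \<Longrightarrow> A $$ (i, j) \<noteq> 0 \<longleftrightarrow> (f i, f j) \<in> parcs G"
    using A by (auto simp: graph_mats_def n_def)
  define g where "g = the_inv_into {..<n} f"
  have bg: "bij_betw g (pverts G) {..<n}"
    unfolding g_def by (rule bij_betw_the_inv_into[OF f])
  have g: "g x < n" "f (g x) = x" if "x \<in> pverts G" for x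
    using that bij_betwE[OF bg] f_the_inv_into_f_bij_betw[OF f, of x] by (auto simp: g_def)
  have g_inj: "g x = g y \<longleftrightarrow> x = y" if "x \<in> pverts G" "y \<in> pverts G" for x y
    using g that by metis
  define a where "a x y = A $$ (g x, g y)" for x y
  define c where "c x y = adj_mat A $$ (g x, g y) / det A" for x y
  note adj = adj_mat[OF cA]
  have adj_entry: "adj_mat A $$ (i, j) = (-1) ^ (i + j) * det (mat_delete A j i)"
    if "i < n" "j < n" for i j
    using that cA by (simp add: adj_mat_def cofactor_def add.commute)
  have "hollow_inverse (pverts G) a c"
  proof
    fix x y assume xy: "x \<in> pverts G" "y \<in> pverts G"
    show "a x y = a y x"
      using arg_cong[OF sA, of "\<lambda>B. B $$ (g x, g y)"] cA g(1)[OF xy(1)] g(1)[OF xy(2)]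
      by (simp add: a_def)
    show "c x y = c y x"
      using det_mat_delete_swap[OF cA sA, of "g x" "g y"] g(1)[OF xy(1)] g(1)[OF xy(2)]
      by (simp add: c_def adj_entry add.commute)
    have "(\<Sum>z\<in>pverts G. a x z * c z y) = (\<Sum>k<n. A $$ (g x, k) * (adj_mat A $$ (k, g y) / det A))"
      unfolding a_def c_def by (rule sum.reindex_bij_betw[OF bg])
    also have "\<dots> = (A * adj_mat A) $$ (g x, g y) / det A"
      using cA adj(1) g(1)[OF xy(1)] g(1)[OF xy(2)]
      by (simp add: scalar_prod_def sum_divide_distrib lessThan_atLeast0)
    also have "\<dots> = (if x = y then 1 else 0)"
      using adj(2) dA g(1)[OF xy(1)] g(1)[OF xy(2)] g_inj[OF xy] by simp
    finally show "(\<Sum>z\<in>pverts G. a x z * c z y) = (if x = y then 1 else 0)" .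
  next
    fix x assume "x \<in> pverts G"
    then show "c x x = 0" using g(1) dd by (simp add: c_def adj_entry)
  qed (rule fin)
  moreover have "a x y \<noteq> 0 \<longleftrightarrow> (x, y) \<in> parcs G"
    if "x \<in> pverts G" "y \<in> pverts G" "x \<noteq> y" for x y
    using pat[of "g x" "g y"] g that g_inj by (simp add: a_def)
  ultimately show thesis by (rule that)
qed

text \<open>Serves \<open>G32\<close>: an explicit inverse replaces the evaluation of determinants
  of order 10 and 9.\<close>

lemma parter_graphI:
  assumes "hollow_inverse (pverts G) a c"
    and pat: "\<And>x y. x \<in> pverts G \<Longrightarrow> y \<in> pverts G \<Longrightarrow> x \<noteq> y \<Longrightarrow> a x y \<noteq> 0 \<longleftrightarrow> (x, y) \<in> parcs G"
  shows "parter_graph G"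
proof -
  interpret hollow_inverse "pverts G" a c by fact
  define n where "n = card (pverts G)"
  obtain f where f: "bij_betw f {..<n} (pverts G)"
    using ex_bij_betw_nat_finite[OF finite_V] by (auto simp: n_def lessThan_atLeast0)
  have fV: "f i \<in> pverts G" if "i < n" for i
    using bij_betwE[OF f] that by blast
  have f_inj: "f i = f j \<longleftrightarrow> i = j" if "i < n" "j < n" for i j
    using bij_betw_imp_inj_on[OF f] that by (auto dest: inj_onD)
  define A where "A = mat n n (\<lambda>(i, j). a (f i) (f j))"
  define C where "C = mat n n (\<lambda>(i, j). c (f i) (f j))"
  have cA: "A \<in> carrier_mat n n" and cC: "C \<in> carrier_mat n n"
    by (auto simp: A_def C_def)
  have AC: "A * C = 1\<^sub>m n"
  proof (rule eq_matI)
    fix i j assume "i < dim_row (1\<^sub>m n :: real mat)" "j < dim_col (1\<^sub>m n :: real mat)"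
    then have ij: "i < n" "j < n" by auto
    have "(A * C) $$ (i, j) = (\<Sum>k<n. a (f i) (f k) * c (f k) (f j))"
      using ij by (simp add: A_def C_def scalar_prod_def lessThan_atLeast0)
    also have "\<dots> = (\<Sum>y\<in>pverts G. a (f i) y * c y (f j))"
      by (rule sum.reindex_bij_betw[OF f])
    also have "\<dots> = 1\<^sub>m n $$ (i, j)"
      using inverse[OF fV fV, OF ij] f_inj[OF ij] ij by simp
    finally show "(A * C) $$ (i, j) = 1\<^sub>m n $$ (i, j)" .
  qed (auto simp: A_def C_def)
  have "det A * det C = 1"
    using arg_cong[OF AC, of det] det_mult[OF cA cC] by simp
  then have dA: "det A \<noteq> 0" by auto
  note adj = adj_mat[OF cA]
  \<comment> \<open>Uniqueness of the inverse, in the form that identifies the adjugate, whose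
    diagonal entries are the minors in question.\<close>
  have "adj_mat A = adj_mat A * (A * C)"
    using adj(1) by (simp add: AC)
  also have "\<dots> = (adj_mat A * A) * C"
    using adj(1) cA cC by simp
  also have "\<dots> = det A \<cdot>\<^sub>m C"
    using mult_smult_assoc_mat[OF one_carrier_mat cC] cC by (simp add: adj(3))
  finally have adjC: "adj_mat A = det A \<cdot>\<^sub>m C" .
  have "det (mat_delete A i i) = 0" if i: "i < n" for i
  proof -
    have "det (mat_delete A i i) = adj_mat A $$ (i, i)"
      using i cA by (simp add: adj_mat_def cofactor_def)
    then show ?thesis
      using i c_diag[OF fV[OF i]] by (simp add: adjC C_def)
  qed
  moreover have "A\<^sup>T = A"
    using a_sym fV by (intro eq_matI) (auto simp: A_def)
  then have "A \<in> graph_mats G f"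
    using cA pat fV f_inj by (simp add: graph_mats_def n_def[symmetric]) (simp add: A_def)
  ultimately show ?thesis
    using f dA unfolding parter_graph_def n_def[symmetric] by blast
qed

text \<open>A connected symmetric digraph is strongly connected, so its whole vertex set is the only
  component. This gives the last term of \<open>cycle_rank\<close>.\<close>

lemma card_sccs_verts_connected:
  assumes "pair_graph G" "Digraph_Component.connected (with_proj G)"
  shows "card (pre_digraph.sccs_verts (with_proj G)) = 1"
proof -
  interpret pair_graph G by fact
  have sc: "strongly_connected (with_proj G)"
    using symmetric_connected_imp_strongly_connected assms(2) sym_arcs by blast
  then have reach: "u \<rightarrow>\<^sup>*\<^bsub>with_proj G\<^esub> v" if "u \<in> pverts G" "v \<in> pverts G" for u v
    using that by (auto simp: strongly_connected_def)
  obtain u where u: "u \<in> pverts G" using sc by (auto simp: strongly_connected_def)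
  have "sccs_verts = {pverts G}"
  proof (intro equalityI subsetI)
    fix S assume S: "S \<in> sccs_verts"
    have "S \<subseteq> pverts G" using sccs_verts_subsets[OF S] .
    moreover have "pverts G \<subseteq> S"
      using S reach \<open>S \<subseteq> pverts G\<close> unfolding sccs_verts_def by blast
    ultimately show "S \<in> {pverts G}" by blast
  next
    fix S assume "S \<in> {pverts G}"
    then have S: "S = pverts G" by simp
    have "v \<in> pverts G" if "x \<rightarrow>\<^sup>*\<^bsub>with_proj G\<^esub> v" for x v
      using reachable_in_verts(2)[OF that] .
    then show "S \<in> sccs_verts"
      unfolding sccs_verts_def S using reach u by blast
  qed
  then show ?thesis by simp
qed

text \<open>Exactly one of the two arcs of an edge runs from \<open>X\<close> to
  \<open>Y\<close>.\<close>

lemma card_uedges_bipartite: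
  assumes "pair_graph G" "bipartition G X Y"
  shows "card (uedges G) = card (parcs G \<inter> X \<times> Y)"
proof -
  interpret pair_graph G by fact
  have XY: "X \<inter> Y = {}" "parcs G \<subseteq> X \<times> Y \<union> Y \<times> X"
    using assms(2) by (auto simp: bipartition_def)
  have sym: "(v, u) \<in> parcs G" if "(u, v) \<in> parcs G" for u v
    using arcs_symmetric that .
  have "uedges G = (\<lambda>(u, v). {u, v}) ` (parcs G \<inter> X \<times> Y)" (is "_ = ?R")
  proof (intro equalityI subsetI)
    fix e assume "e \<in> uedges G"
    then obtain u v where uv: "e = {u, v}" "(u, v) \<in> parcs G" by (auto simp: uedges_def)
    then consider "u \<in> X" "v \<in> Y" | "u \<in> Y" "v \<in> X" using XY by blast
    then show "e \<in> ?R"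
    proof cases
      case 1
      then show ?thesis using uv by force
    next
      case 2
      then show ?thesis using uv sym[OF uv(2)] by (intro image_eqI[of _ _ "(v, u)"]) auto
    qed
  qed (auto simp: uedges_def)
  moreover have "inj_on (\<lambda>(u, v). {u, v}) (parcs G \<inter> X \<times> Y)"
    using XY(1) by (auto simp: inj_on_def doubleton_eq_iff)
  ultimately show ?thesis by (simp add: card_image)
qed

text \<open>An injection between finite sets of equal size is onto, so the edges from
  \<open>x\<close> to \<open>f x\<close> also cover \<open>Y\<close>, each vertex once.\<close>

lemma perfect_matchingI:
  assumes "bipartition G X Y" "card X = card Y" "finite Y"
    and f: "inj_on f X" "\<And>x. x \<in> X \<Longrightarrow> (x, f x) \<in> parcs G"
  shows "\<exists>M. perfect_matching G M"
proof -
  have XY: "X \<union> Y = pverts G" "X \<inter> Y = {}" "parcs G \<subseteq> X \<times> Y \<union> Y \<times> X"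
    using assms(1) by (auto simp: bipartition_def)
  have fY: "f x \<in> Y" if "x \<in> X" for x
    using f(2)[OF that] XY that by blast
  then have "f ` X = Y"
    using assms(2,3) card_image[OF f(1)] by (intro card_subset_eq) auto
  define M where "M = (\<lambda>x. {x, f x}) ` X"
  have "\<forall>v\<in>pverts G. \<exists>!e. e \<in> M \<and> v \<in> e"
  proof
    fix v assume "v \<in> pverts G"
    then consider "v \<in> X" | "v \<in> Y" using XY by blast
    then obtain x where x: "x \<in> X" "v \<in> {x, f x}"
      using \<open>f ` X = Y\<close> by cases auto
    have uniq: "y = x" if y: "y \<in> X" "v \<in> {y, f y}" for y
      using x y fY[OF x(1)] fY[OF y(1)] XY(2) inj_onD[OF f(1), of x y] by blast
    show "\<exists>!e. e \<in> M \<and> v \<in> e"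
    proof (rule ex1I[of _ "{x, f x}"])
      show "{x, f x} \<in> M \<and> v \<in> {x, f x}" using x unfolding M_def by blast
      fix e assume "e \<in> M \<and> v \<in> e"
      then obtain y where "y \<in> X" "e = {y, f y}" "v \<in> {y, f y}" unfolding M_def by blast
      with uniq[of y] show "e = {x, f x}" by simp
    qed
  qed
  moreover have "M \<subseteq> uedges G"
    using f(2) by (auto simp: M_def uedges_def)
  ultimately show ?thesis unfolding perfect_matching_def by (intro exI[of _ M] conjI)
qed

text \<open>Arcs under \<open>with_proj\<close> are pairs of vertices, so the vertex map
  \<open>h\<close> determines the arc map.\<close>

lemma digraph_iso_with_projI:
  assumes "pair_wf_digraph G" "inj_on h (pverts G)" "pverts H = h ` pverts G"
    and "parcs H = map_prod h h ` parcs G"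
  shows "digraph_iso (with_proj G) (with_proj H)"
proof -
  interpret pair_wf_digraph G by fact
  define hom where "hom = \<lparr>iso_verts = h, iso_arcs = map_prod h h, iso_head = snd, iso_tail = fst\<rparr>"
  have "parcs G \<subseteq> pverts G \<times> pverts G" using wellformed' by auto
  then have "inj_on (map_prod h h) (parcs G)"
    using map_prod_inj_on[OF assms(2) assms(2)] inj_on_subset by blast
  then have "digraph_isomorphism hom"
    using assms(2) wf_digraph_axioms by (simp add: digraph_isomorphism_def hom_def)
  moreover have "with_proj H = app_iso hom (with_proj G)"
    using assms(3,4) by (simp add: app_iso_def hom_def with_proj_def)
  ultimately show ?thesis by (auto simp: digraph_iso_def)
qed

section \<open>The graph \<open>G32\<close>\<close>

text \<open>
  A nonsingular matrix of \<^const>\<open>G32\<close> whose inverse has zero diagonal: the blocks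
  \<open>{u1, u2, u3} \<times> {v1, v2}\<close> and \<open>{u4, u5} \<times> {v3, v4, v5}\<close> are all ones, and the
  diagonal is chosen so that the Schur complement on \<open>{v1, v2, u4, u5}\<close> has zero diagonal.
\<close>

fun G32_mat :: "nat + nat \<Rightarrow> nat + nat \<Rightarrow> real" where
  "G32_mat (Inl i) (Inl j) = (if i \<noteq> j then 0 else if i \<le> 3 then -1 else -3)"
| "G32_mat (Inr i) (Inr j) = (if i \<noteq> j then 0 else if i \<le> 2 then -3 else -1)"
| "G32_mat (Inl i) (Inr j) = (if (i, j) \<in> G32_uv then if (i, j) = (5, 2) then 3 else 1 else 0)"
| "G32_mat (Inr j) (Inl i) = (if (i, j) \<in> G32_uv then if (i, j) = (5, 2) then 3 else 1 else 0)"

fun G32_inv_uv :: "nat \<Rightarrow> nat \<Rightarrow> real" where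
  "G32_inv_uv i j =
    (if i \<le> 3 then if j \<le> 2 then 1/2 else -2/3
     else if j > 2 then 1/2 else if (i, j) = (4, 1) then -1/2
     else if (i, j) = (5, 2) then -1/6 else 0)"

text \<open>The inverse of \<open>G32_mat\<close> by block elimination. The Schur complement is a
  weighted 4-cycle: 3 on \<open>v1 v2\<close> and \<open>u4 u5\<close>, 1 on \<open>u4 v1\<close>, 3
  on \<open>u5 v2\<close>. Its inverse has the entry \<open>3 / (9 - 3) = 1/2\<close> at
  \<open>v1 v2\<close> and at \<open>u4 u5\<close>, so an eliminated vertex gets the diagonal entry
  \<open>-1 + 2 * 1/2 = 0\<close>. The weight 3 on \<open>u5 v2\<close> is chosen for this.\<close>

fun G32_inv :: "nat + nat \<Rightarrow> nat + nat \<Rightarrow> real" where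
  "G32_inv (Inl i) (Inl j) =
    (if i = j then 0 else if i \<le> 3 \<and> j \<le> 3 then 1 else if i > 3 \<and> j > 3 then 1/2
     else if i = 4 \<or> j = 4 then -1/2 else -1/6)"
| "G32_inv (Inr i) (Inr j) =
    (if i = j then 0 else if i \<le> 2 \<and> j \<le> 2 then 1/2 else if i > 2 \<and> j > 2 then 1
     else if i = 1 \<or> j = 1 then -1/2 else -1/6)"
| "G32_inv (Inl i) (Inr j) = G32_inv_uv i j"
| "G32_inv (Inr j) (Inl i) = G32_inv_uv i j"

lemma atLeastAtMost_1_5: "{1..5} = {1, 2, 3, 4, 5 :: nat}"
  by auto

lemma pverts_G32:
  "pverts G32 = {Inl 1, Inl 2, Inl 3, Inl 4, Inl 5, Inr 1, Inr 2, Inr 3, Inr 4, Inr 5}"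
  unfolding G32_def atLeastAtMost_1_5 by auto

lemma parcs_G32:
  "(Inl i, Inr j) \<in> parcs G32 \<longleftrightarrow> (i, j) \<in> G32_uv"
  "(Inr j, Inl i) \<in> parcs G32 \<longleftrightarrow> (i, j) \<in> G32_uv"
  "(Inl i, Inl i') \<notin> parcs G32" "(Inr j, Inr j') \<notin> parcs G32"
  by (auto simp: G32_def)

lemma hollow_inverse_G32: "hollow_inverse (pverts G32) G32_mat G32_inv"
proof
  fix x y assume xy: "x \<in> pverts G32" "y \<in> pverts G32"
  show "G32_mat x y = G32_mat y x" by (cases x; cases y) auto
  show "G32_inv x y = G32_inv y x" by (cases x; cases y) auto
  show "(\<Sum>z\<in>pverts G32. G32_mat x z * G32_inv z y) = (if x = y then 1 else 0)"
    using xy unfolding pverts_G32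
    by (elim insertE; simp add: G32_uv_def del: One_nat_def)
next
  fix x assume "x \<in> pverts G32"
  show "G32_inv x x = 0" by (cases x) auto
qed (simp add: pverts_G32)

lemma parter_graph_G32: "parter_graph G32"
proof (rule parter_graphI[OF hollow_inverse_G32])
  fix x y :: "nat + nat" assume "x \<noteq> y"
  then show "G32_mat x y \<noteq> 0 \<longleftrightarrow> (x, y) \<in> parcs G32"
    by (cases x; cases y) (auto simp: parcs_G32)
qed

lemma pair_graph_G32: "pair_graph G32"
proof
  show "finite (parcs G32)" by (simp add: G32_def G32_uv_def)
  show "symmetric (with_proj G32)"
    unfolding symmetric_def sym_def by (auto simp: G32_def)
qed (auto simp: G32_def G32_uv_def)

lemma bipartition_G32: "bipartition G32 (Inl ` {1..5}) (Inr ` {1..5})"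
  by (auto simp: bipartition_def G32_def G32_uv_def)

lemma card_G32_uv: "card G32_uv = 14"
  by (simp add: G32_uv_def insert_Times_insert)

lemma card_uedges_G32: "card (uedges G32) = 14"
proof -
  have "parcs G32 \<inter> Inl ` {1..5} \<times> Inr ` {1..5} = map_prod Inl Inr ` G32_uv"
    by (auto simp: G32_def G32_uv_def)
  moreover have "inj_on (map_prod Inl Inr :: _ \<Rightarrow> (nat + nat) \<times> (nat + nat)) G32_uv" by (auto simp: inj_on_def)
  ultimately show ?thesis
    by (simp add: card_uedges_bipartite[OF pair_graph_G32 bipartition_G32] card_image card_G32_uv)
qed

lemma connected_G32: "Digraph_Component.connected (with_proj G32)"
proof -
  interpret pair_graph G32 by (rule pair_graph_G32)
  have adj: "Inl i \<rightarrow>\<^sup>*\<^bsub>with_proj G32\<^esub> Inr j" "Inr j \<rightarrow>\<^sup>*\<^bsub>with_proj G32\<^esub> Inl i"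
    if "(i, j) \<in> G32_uv" for i j
    using that by (auto intro!: reachable_adjI simp: parcs_G32)
  have r1: "Inr 1 \<rightarrow>\<^sup>*\<^bsub>with_proj G32\<^esub> Inl 4"
    by (intro adj(2)) (auto simp: G32_uv_def)
  have r3: "Inr j \<rightarrow>\<^sup>*\<^bsub>with_proj G32\<^esub> Inl 4" if "j \<in> {3, 4, 5}" for j
    using that by (auto intro!: adj(2) simp: G32_uv_def)
  have l1: "Inl i \<rightarrow>\<^sup>*\<^bsub>with_proj G32\<^esub> Inl 4" if "i \<in> {1, 2, 3}" for i
    using that by (intro reachable_trans[OF adj(1)[of i 1] r1]) (auto simp: G32_uv_def)
  have r2: "Inr 2 \<rightarrow>\<^sup>*\<^bsub>with_proj G32\<^esub> Inl 4"
    by (intro reachable_trans[OF adj(2)[of 1 2] l1]) (auto simp: G32_uv_def)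
  have l5: "Inl 5 \<rightarrow>\<^sup>*\<^bsub>with_proj G32\<^esub> Inl 4"
    by (intro reachable_trans[OF adj(1)[of 5 3] r3]) (auto simp: G32_uv_def)
  \<comment> \<open>Reaching the hub \<open>Inl 4\<close> from every vertex suffices, since walks in
    a symmetric digraph can be reversed.\<close>
  have to4: "v \<rightarrow>\<^sup>*\<^bsub>with_proj G32\<^esub> Inl 4" if "v \<in> pverts G32" for v
    using that r1 r2 r3 l1 l5 reachable_refl[of "Inl 4"] unfolding pverts_G32 by auto
  have "u \<rightarrow>\<^sup>*\<^bsub>with_proj G32\<^esub> v" if "u \<in> pverts G32" "v \<in> pverts G32" for u v
    using reachable_trans[OF to4 symmetric_reachable'[OF to4]] that .
  then show ?thesis
    using reachable_mk_symmetric_eq[OF sym_arcs]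
    by (auto simp: Digraph_Component.connected_def strongly_connected_def pverts_G32)
qed

text \<open>Pigeonhole: \<open>u1\<close>, \<open>u2\<close>, \<open>u3\<close> would need distinct
  partners among their only neighbours \<open>v1\<close>, \<open>v2\<close>.\<close>

lemma no_perfect_matching_G32: "\<not> perfect_matching G32 M"
proof
  assume M: "perfect_matching G32 M"
  have "\<exists>j\<in>{1, 2}. {Inl i, Inr j} \<in> M" if "i \<in> {1, 2, 3}" for i
  proof -
    have "Inl i \<in> pverts G32" using that by (auto simp: pverts_G32)
    then obtain e where e: "e \<in> M" "Inl i \<in> e" "e \<in> uedges G32"
      using M unfolding perfect_matching_def by blast
    then obtain u v where uv: "e = {u, v}" "(u, v) \<in> parcs G32" by (auto simp: uedges_def)
    with e that show ?thesis
      by (auto simp: G32_def G32_uv_def insert_commute)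
  qed
  then obtain f :: "nat \<Rightarrow> nat" where f: "\<And>i. i \<in> {1, 2, 3} \<Longrightarrow> f i \<in> {1, 2} \<and> {Inl i, Inr (f i)} \<in> M"
    by metis
  have "inj_on f {1, 2, 3}"
  proof (rule inj_onI)
    fix i k assume ik: "i \<in> {1, 2, 3}" "k \<in> {1, 2, 3}" "f i = f k"
    have "Inr (f i) \<in> pverts G32" using f[OF ik(1)] by (auto simp: pverts_G32)
    then have "{Inl i, Inr (f i)} = {Inl k, Inr (f k)}"
      using f[OF ik(1)] f[OF ik(2)] ik(3) M unfolding perfect_matching_def by (metis insertCI)
    then show "i = k" by (auto simp: doubleton_eq_iff)
  qed
  then have "card {1, 2, 3 :: nat} \<le> card {1, 2 :: nat}"
    using f by (intro card_inj_on_le[of f]) auto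
  then show False by simp
qed

section \<open>Uniqueness\<close>

lemma digraph_iso_G32:
  fixes G :: "'a pair_pre_digraph"
  assumes G: "pair_graph G" and conn: "Digraph_Component.connected (with_proj G)"
    and bal: "balanced_bipartite G" and ord: "card (pverts G) = 10" and cyc: "cycle_rank G = 5"
    and parter: "parter_graph G" and npm: "\<nexists>M. perfect_matching G M"
  shows "digraph_iso (with_proj G) (with_proj G32)"
proof -
  interpret pair_graph G by fact
  interpret G32: pair_graph G32 by (rule pair_graph_G32)
  obtain X Y where bip: "bipartition G X Y" and eq: "card X = card Y"
    using bal by (auto simp: balanced_bipartite_def)
  have XY: "pverts G = X \<union> Y" "X \<inter> Y = {}" "parcs G \<subseteq> X \<times> Y \<union> Y \<times> X"
    using bip by (auto simp: bipartition_def)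
  have fin: "finite X" "finite Y" using pair_finite_verts XY(1) by simp_all
  have cX: "card X = 5" and cY: "card Y = 5"
    using ord eq card_Un_disjoint[OF fin XY(2)] by (simp_all add: XY(1))
  define E where "E = parcs G \<inter> X \<times> Y"
  \<comment> \<open>Cycle rank 5, order 10 and one component:
    \<open>14 - 10 + 1 = 5\<close>.\<close>
  have cE: "card E = 14"
    using cyc card_sccs_verts_connected[OF G conn] ord card_uedges_bipartite[OF G bip]
    by (simp add: cycle_rank_def E_def)
  define N where "N x = {y \<in> Y. (x, y) \<in> E}" for x
  \<comment> \<open>Hall's condition would yield a perfect matching, so some \<open>S\<close> is
    deficient.\<close>
  have "\<not> (\<forall>S\<subseteq>X. card S \<le> card (\<Union>(N ` S)))"
  proof
    assume hall: "\<forall>S\<subseteq>X. card S \<le> card (\<Union>(N ` S))"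
    have "\<exists>f. inj_on f X \<and> (\<forall>x\<in>X. f x \<in> N x)"
      using hall fin by (intro hall_marriage) (auto simp: N_def)
    then obtain f where f: "inj_on f X" "\<forall>x\<in>X. f x \<in> N x" by blast
    have "\<exists>M. perfect_matching G M"
      by (rule perfect_matchingI[OF bip eq fin(2) f(1)]) (use f(2) in \<open>simp add: N_def E_def\<close>)
    with npm show False by blast
  qed
  then obtain S where S: "S \<subseteq> X" "card (\<Union>(N ` S)) < card S" by (auto simp: not_le)
  obtain a c where ac: "hollow_inverse (pverts G) a c"
    and pat: "\<And>x y. x \<in> pverts G \<Longrightarrow> y \<in> pverts G \<Longrightarrow> x \<noteq> y \<Longrightarrow> a x y \<noteq> 0 \<longleftrightarrow> (x, y) \<in> parcs G"
    using parter_graphD[OF pair_finite_verts parter] by blast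
  interpret hollow_inverse "pverts G" a c by fact
  have pat_XY: "a x y \<noteq> 0 \<longleftrightarrow> (x, y) \<in> parcs G" if "x \<in> X" "y \<in> Y" for x y
    using that XY by (intro pat) auto
  obtain s1 s2 s3 p p' t t' r1 r2 r3
    where dist: "distinct [s1, s2, s3, p, p', t, t', r1, r2, r3]"
      and X: "X = {s1, s2, s3, p, p'}" and Y: "Y = {t, t', r1, r2, r3}"
      and E: "E = {s1, s2, s3} \<times> {t, t'} \<union> {p, p'} \<times> {r1, r2, r3} \<union> {(p, t), (p', t')}"
  proof (rule structure_of_deficient[OF XY(1,2) cX cY _ _ cE S(1)])
    show "x \<in> X \<longleftrightarrow> y \<in> Y" if "x \<in> pverts G" "y \<in> pverts G" "x \<noteq> y" "a x y \<noteq> 0" for x y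
      using pat[OF that(1-3)] that(4) XY by blast
    show "E = {(x, y) \<in> X \<times> Y. a x y \<noteq> 0}"
      using pat_XY by (auto simp: E_def)
    show "\<Union>(N ` S) = {y \<in> Y. \<exists>x\<in>S. a x y \<noteq> 0}"
      using pat_XY S(1) by (auto simp: N_def E_def)
  qed (rule S(2))
  \<comment> \<open>\<open>p\<close>, \<open>p'\<close> take the places of \<open>u4\<close>,
    \<open>u5\<close>, and \<open>t\<close>, \<open>t'\<close> those of \<open>v1\<close>,
    \<open>v2\<close>. List positions start at 0 and vertex labels at 1, hence \<open>i - 1\<close>
    and \<open>j - 1\<close>.\<close>
  define h where
    "h = case_sum (\<lambda>i. [s1, s2, s3, p, p'] ! (i - 1)) (\<lambda>j. [t, t', r1, r2, r3] ! (j - 1))"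
  have h: "h (Inl 1) = s1" "h (Inl 2) = s2" "h (Inl 3) = s3" "h (Inl 4) = p" "h (Inl 5) = p'"
    "h (Inr 1) = t" "h (Inr 2) = t'" "h (Inr 3) = r1" "h (Inr 4) = r2" "h (Inr 5) = r3"
    by (simp_all add: h_def)
  \<comment> \<open>The map runs from \<open>G32\<close>, whose vertices are explicit; the
    isomorphism is reversed at the end.\<close>
  have "digraph_iso (with_proj G32) (with_proj G)"
  proof (rule digraph_iso_with_projI)
    show "pair_wf_digraph G32" by (rule G32.pair_wf_digraph_axioms)
    have "distinct (map h [Inl 1, Inl 2, Inl 3, Inl 4, Inl 5, Inr 1, Inr 2, Inr 3, Inr 4, Inr 5])"
      using dist by (simp only: list.map h)
    then have "inj_on h (set [Inl 1, Inl 2, Inl 3, Inl 4, Inl 5, Inr 1, Inr 2, Inr 3, Inr 4, Inr 5])"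
      by (simp only: distinct_map)
    then show "inj_on h (pverts G32)"
      by (simp only: pverts_G32 list.set)
    show "pverts G = h ` pverts G32"
      unfolding pverts_G32 XY(1) X Y image_insert image_empty h by auto
    have "E = (\<lambda>(i, j). (h (Inl i), h (Inr j))) ` G32_uv"
      unfolding E G32_uv_def insert_Times_insert
      by (simp add: h[unfolded One_nat_def] insert_Times_insert)
    then have "parcs G \<inter> X \<times> Y = map_prod h h ` (\<lambda>(i, j). (Inl i, Inr j)) ` G32_uv"
      by (simp add: E_def image_image case_prod_unfold)
    \<comment> \<open>By symmetry the arcs from \<open>X\<close> to \<open>Y\<close> determine all
      arcs, so matching \<open>E\<close> with \<open>G32_uv\<close> is enough.\<close>
    moreover have "parcs G = (parcs G \<inter> X \<times> Y) \<union> prod.swap ` (parcs G \<inter> X \<times> Y)"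
      using XY(3) arcs_symmetric by force
    ultimately show "parcs G = map_prod h h ` parcs G32"
      by (simp add: G32_def image_Un image_image case_prod_unfold)
  qed
  then show ?thesis
    by (rule digraph_iso_swap[OF G32.wf_digraph_axioms])
qed

theorem proposition4p2:
  shows "(pair_graph G32
     \<and> Digraph_Component.connected (with_proj G32)
     \<and> balanced_bipartite G32
     \<and> card (pverts G32) = 10
     \<and> cycle_rank G32 = 5
     \<and> parter_graph G32
     \<and> \<not> (\<exists>M. perfect_matching G32 M))
   \<and> (\<forall>G :: 'a pair_pre_digraph.
     pair_graph G
     \<and> Digraph_Component.connected (with_proj G)
     \<and> balanced_bipartite G
     \<and> card (pverts G) = 10
     \<and> cycle_rank G = 5
     \<and> parter_graph G
     \<and> \<not> (\<exists>M. perfect_matching G M)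
     \<longrightarrow> digraph_iso (with_proj G) (with_proj G32))"
proof -
  have order: "card (pverts G32) = 10" by (simp add: pverts_G32)
  moreover have "balanced_bipartite G32"
    unfolding balanced_bipartite_def
    by (intro exI conjI, rule bipartition_G32) (simp add: card_image)
  moreover have "cycle_rank G32 = 5"
    by (simp add: cycle_rank_def card_uedges_G32 order
        card_sccs_verts_connected[OF pair_graph_G32 connected_G32])
  ultimately show ?thesis
    using pair_graph_G32 connected_G32 parter_graph_G32 no_perfect_matching_G32 digraph_iso_G32
    by blast
qed

end
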